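(* In the data markets game with joint externality under the transaction cost $\mathcal{T}_i(S)=\alpha\sum_{j\ne i}\big(\hat{E}_{ji}(\gamma_i,\gamma_j)-\hat{E}_{ij}(\gamma_i,\gamma_j)\big)$ with $\alpha\in[0,1]$, let $$\varepsilon=\max_i\Big\{2|\alpha-0.5|\sum_{j\ne i}\max_{\gamma_i,\gamma_j}\big|\hat{e}_{ji}(\gamma_i,\gamma_j)-\hat{e}_{ij}(\gamma_i,\gamma_j)\big|+\sum_{j\ne i}\max_{\gamma_i,\gamma_j}\big|b_{ij}(\gamma_i,\gamma_j)-b_{ji}(\gamma_i,\gamma_j)\big|\Big\}.$$ Then there always exists an $\varepsilon$-pure Nash equilibrium $S^q$ whose welfare regret is at most $\tfrac{n}{2}$, i.e. $\max_S sw(S)-sw(S^q)\le\tfrac n2$.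
   Context: Data markets game with joint externality: there are $n$ buyers and $k$ sellers. Each buyer $i$ simultaneously chooses a seller set $\gamma_i$ (a subset of the sellers, possibly empty); $S=(\gamma_1,\dots,\gamma_n)$. Buyer $i$'s expected net gain is $g_i(\gamma)\in[-1,1]$, with $g_i(\emptyset)=0$. The externality that buyer $i$ suffers from buyer $j\ne i$ is random with mean $e_{ij}(\gamma_i,\gamma_j)\ge0$, depending on both orders. Notational convention: in both $e_{ij}(\gamma_i,\gamma_j)$ and $e_{ji}(\gamma_i,\gamma_j)$, $\gamma_i$ is what $i$ buys and $\gamma_j$ is what $j$ buys (and similarly for $\hat{e}$, $b$). Total caused externality is normalized: $\sum_{j\ne i}e_{ji}(\gamma_i,\gamma_j)\in[0,1]$ for every $i$ and every profile. The platform has random predicted externalities $\hat{E}_{ij}(\gamma_i,\gamma_j)$ with means $\hat{e}_{ij}(\gamma_i,\gamma_j)$ and bias $b_{ij}(\gamma_i,\gamma_j)=e_{ij}(\gamma_i,\gamma_j)-\hat{e}_{ij}(\gamma_i,\gamma_j)$. Buyer $i$'s expected utility is $$u_i(S)=g_i(\gamma_i)-\sum_{j\ne i}e_{ij}(\gamma_i,\gamma_j)-\alpha\sum_{j\ne i}\big(\hat{e}_{ji}(\gamma_i,\gamma_j)-\hat{e}_{ij}(\gamma_i,\gamma_j)\big),$$ and the social welfare is $sw(S)=\sum_iu_i(S)$. A profile $S^q=(\gamma_1^q,\dots,\gamma_n^q)$ is an $\varepsilon$-pure Nash equilibrium if no buyer $i$ can increase her expected utility by more than $\varepsilon$ by unilaterally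 deviating from $\gamma_i^q$. *)

theory Defs
  imports "HOL-Probability.Probability"
begin

text \<open>
  Buyers and sellers form finite types, so the numbers of buyers and sellers are their cardinalities,
  a buyer's order is an arbitrary set of sellers, and a profile is a function from buyers to orders.

  Argument order: in \<open>externality G i j x y\<close> (what \<open>i\<close> suffers from \<open>j\<close>) and in everything derived
  from it, \<open>x\<close> is the order of the first index \<open>i\<close> and \<open>y\<close> the order of the second index \<open>j\<close>.
  If orders are written independently of the index order, so that \<open>x\<close> always belongs to \<open>i\<close> and
  \<open>y\<close> to \<open>j\<close>, the quantity with swapped indices at the same orders is \<open>externality G j i y x\<close>.
  Values on the diagonal \<open>i = j\<close> are irrelevant and unconstrained.
\<close>

record ('w, 'b, 's) data_market =
  outcomes :: "'w measure"
  net_gain :: "'b \<Rightarrow> 's set \<Rightarrow> real"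
  externality :: "'b \<Rightarrow> 'b \<Rightarrow> 's set \<Rightarrow> 's set \<Rightarrow> 'w \<Rightarrow> real"
  prediction :: "'b \<Rightarrow> 'b \<Rightarrow> 's set \<Rightarrow> 's set \<Rightarrow> 'w \<Rightarrow> real"

definition mean_externality ::
  "('w, 'b, 's) data_market \<Rightarrow> 'b \<Rightarrow> 'b \<Rightarrow> 's set \<Rightarrow> 's set \<Rightarrow> real" where
  "mean_externality G i j x y = (LINT \<omega>|outcomes G. externality G i j x y \<omega>)"

definition mean_prediction ::
  "('w, 'b, 's) data_market \<Rightarrow> 'b \<Rightarrow> 'b \<Rightarrow> 's set \<Rightarrow> 's set \<Rightarrow> real" where
  "mean_prediction G i j x y = (LINT \<omega>|outcomes G. prediction G i j x y \<omega>)"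

definition bias ::
  "('w, 'b, 's) data_market \<Rightarrow> 'b \<Rightarrow> 'b \<Rightarrow> 's set \<Rightarrow> 's set \<Rightarrow> real" where
  "bias G i j x y = mean_externality G i j x y - mean_prediction G i j x y"

locale joint_externality_game = prob_space "outcomes G"
  for G :: "('w, 'b::finite, 's::finite) data_market" +
  assumes net_gain_range: "net_gain G i x \<in> {-1..1}"
    and net_gain_empty: "net_gain G i {} = 0"
    and integrable_externality:
      "i \<noteq> j \<Longrightarrow> integrable (outcomes G) (externality G i j x y)"
    and integrable_prediction:
      "i \<noteq> j \<Longrightarrow> integrable (outcomes G) (prediction G i j x y)"
    and mean_externality_nonneg: "i \<noteq> j \<Longrightarrow> 0 \<le> mean_externality G i j x y"
    and caused_externality_normalized:
      "(\<Sum>j\<in>UNIV - {i}. mean_externality G j i (S j) (S i)) \<in> {0..1}"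

definition transaction_cost ::
  "('w, 'b::finite, 's) data_market \<Rightarrow> real \<Rightarrow> 'b \<Rightarrow> ('b \<Rightarrow> 's set) \<Rightarrow> 'w \<Rightarrow> real" where
  "transaction_cost G \<alpha> i S \<omega> =
     \<alpha> * (\<Sum>j\<in>UNIV - {i}. prediction G j i (S j) (S i) \<omega> - prediction G i j (S i) (S j) \<omega>)"

definition expected_utility ::
  "('w, 'b::finite, 's) data_market \<Rightarrow> real \<Rightarrow> 'b \<Rightarrow> ('b \<Rightarrow> 's set) \<Rightarrow> real" where
  "expected_utility G \<alpha> i S =
     net_gain G i (S i)
     - (\<Sum>j\<in>UNIV - {i}. mean_externality G i j (S i) (S j))
     - (LINT \<omega>|outcomes G. transaction_cost G \<alpha> i S \<omega>)"

lemma (in joint_externality_game) expected_utility_eq: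
  "expected_utility G \<alpha> i S =
     net_gain G i (S i)
     - (\<Sum>j\<in>UNIV - {i}. mean_externality G i j (S i) (S j))
     - \<alpha> * (\<Sum>j\<in>UNIV - {i}. mean_prediction G j i (S j) (S i) - mean_prediction G i j (S i) (S j))"
proof -
  have "(LINT \<omega>|outcomes G. (\<Sum>j\<in>UNIV - {i}.
            prediction G j i (S j) (S i) \<omega> - prediction G i j (S i) (S j) \<omega>)) =
        (\<Sum>j\<in>UNIV - {i}. LINT \<omega>|outcomes G.
            prediction G j i (S j) (S i) \<omega> - prediction G i j (S i) (S j) \<omega>)"
    by (rule Bochner_Integration.integral_sum) (auto intro!: integrable_prediction)
  also have "\<dots> = (\<Sum>j\<in>UNIV - {i}.
      mean_prediction G j i (S j) (S i) - mean_prediction G i j (S i) (S j))"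
    unfolding mean_prediction_def
    by (intro sum.cong refl Bochner_Integration.integral_diff) (auto intro!: integrable_prediction)
  finally show ?thesis
    by (simp add: expected_utility_def transaction_cost_def)
qed

definition social_welfare ::
  "('w, 'b::finite, 's) data_market \<Rightarrow> real \<Rightarrow> ('b \<Rightarrow> 's set) \<Rightarrow> real" where
  "social_welfare G \<alpha> S = (\<Sum>i\<in>UNIV. expected_utility G \<alpha> i S)"

definition approx_pure_nash ::
  "('w, 'b::finite, 's) data_market \<Rightarrow> real \<Rightarrow> real \<Rightarrow> ('b \<Rightarrow> 's set) \<Rightarrow> bool" where
  "approx_pure_nash G \<alpha> \<epsilon> S \<longleftrightarrow>
     (\<forall>i x. expected_utility G \<alpha> i (S(i := x)) \<le> expected_utility G \<alpha> i S + \<epsilon>)"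

end

theory Submission
  imports Defs
begin

text \<open>
  Charging each buyer half of the externality she suffers and half of the externality she causes
  yields an exact potential game, whose potential is the total gain minus half of the total
  externality. The true utility of buyer \<open>i\<close> differs from this symmetrised utility by at most
  half of the \<open>i\<close>-th term of \<open>\<epsilon>\<close>, so a maximiser of the potential is an \<open>\<epsilon>\<close>-equilibrium.
  Transaction costs cancel in the welfare, which is therefore the potential minus half of the
  total externality; as the latter lies between \<open>0\<close> and the number of buyers, the maximiser
  loses at most half of that number.
\<close>

lemma sum_offdiag_swap:
  fixes f :: "'b::finite \<Rightarrow> 'b \<Rightarrow> 'a::comm_monoid_add"
  shows "(\<Sum>i\<in>UNIV. \<Sum>j\<in>UNIV - {i}. f j i) = (\<Sum>i\<in>UNIV. \<Sum>j\<in>UNIV - {i}. f i j)"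
  using sum.swap_restrict[of UNIV UNIV "\<lambda>i j. f j i" "\<lambda>i j. i \<noteq> j"]
  by (simp add: set_diff_eq eq_commute)

text \<open>Isolates the ordered pairs that involve \<open>i\<close>, in either position; only these
  can change when buyer \<open>i\<close> deviates.\<close>

lemma sum_offdiag_split:
  fixes f :: "'b::finite \<Rightarrow> 'b \<Rightarrow> 'a::ab_group_add"
  shows "(\<Sum>k\<in>UNIV. \<Sum>j\<in>UNIV - {k}. f k j) =
    (\<Sum>j\<in>UNIV - {i}. f i j + f j i) + (\<Sum>k\<in>UNIV - {i}. \<Sum>j\<in>UNIV - {k} - {i}. f k j)"
proof -
  have "(\<Sum>j\<in>UNIV - {k}. f k j) = f k i + (\<Sum>j\<in>UNIV - {k} - {i}. f k j)" if "k \<in> UNIV - {i}" for k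
    using that by (intro sum.remove) auto
  then have "(\<Sum>k\<in>UNIV - {i}. \<Sum>j\<in>UNIV - {k}. f k j) =
      (\<Sum>k\<in>UNIV - {i}. f k i) + (\<Sum>k\<in>UNIV - {i}. \<Sum>j\<in>UNIV - {k} - {i}. f k j)"
    by (simp add: sum.distrib)
  then show ?thesis
    by (subst sum.remove[of UNIV i]) (simp_all add: sum.distrib add.assoc)
qed

lemma le_MAX_MAX:
  fixes f :: "'x::finite \<Rightarrow> 'y::finite \<Rightarrow> 'a::linorder"
  shows "f x y \<le> (MAX x. MAX y. f x y)"
proof -
  have "f x y \<le> (MAX y. f x y)" by (intro Max_ge) auto
  also have "\<dots> \<le> (MAX x. MAX y. f x y)" by (intro Max_ge) auto
  finally show ?thesis .
qed

definition total_externality ::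
  "('w, 'b::finite, 's) data_market \<Rightarrow> ('b \<Rightarrow> 's set) \<Rightarrow> real" where
  "total_externality G S = (\<Sum>i\<in>UNIV. \<Sum>j\<in>UNIV - {i}. mean_externality G i j (S i) (S j))"

definition potential ::
  "('w, 'b::finite, 's) data_market \<Rightarrow> ('b \<Rightarrow> 's set) \<Rightarrow> real" where
  "potential G S = (\<Sum>i\<in>UNIV. net_gain G i (S i)) - total_externality G S / 2"

text \<open>This is the expected utility at \<open>\<alpha> = 1/2\<close> when all biases
  vanish.\<close>

definition shared_utility ::
  "('w, 'b::finite, 's) data_market \<Rightarrow> 'b \<Rightarrow> ('b \<Rightarrow> 's set) \<Rightarrow> real" where
  "shared_utility G i S = net_gain G i (S i)
     - (\<Sum>j\<in>UNIV - {i}. mean_externality G i j (S i) (S j) + mean_externality G j i (S j) (S i)) / 2"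

text \<open>Half of the externality in every pair involving \<open>i\<close> enters both the
  potential and the shared utility of \<open>i\<close>, so their difference depends on the other
  buyers only.\<close>

lemma potential_deviation:
  "potential G (S(i := x)) - potential G S = shared_utility G i (S(i := x)) - shared_utility G i S"
proof -
  \<comment> \<open>Gains and halved externalities among the buyers other than
    \<open>i\<close>.\<close>
  define R where "R T = (\<Sum>k\<in>UNIV - {i}. net_gain G k (T k))
     - (\<Sum>k\<in>UNIV - {i}. \<Sum>j\<in>UNIV - {k} - {i}. mean_externality G k j (T k) (T j)) / 2" for T
  have "potential G T = shared_utility G i T + R T" for T
    using sum_offdiag_split[of "\<lambda>k j. mean_externality G k j (T k) (T j)" i]
      sum.remove[of UNIV i "\<lambda>k. net_gain G k (T k)"]
    by (simp add: potential_def shared_utility_def total_externality_def R_def field_simps)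
  moreover have "R (S(i := x)) = R S"
    unfolding R_def by (intro arg_cong2[of _ _ _ _ "\<lambda>a b. a - b / 2"] sum.cong) auto
  ultimately show ?thesis by simp
qed

context joint_externality_game
begin

lemma social_welfare_eq: "social_welfare G \<alpha> S = potential G S - total_externality G S / 2"
  using sum_offdiag_swap[of "\<lambda>i j. mean_prediction G i j (S i) (S j)"]
  by (simp add: social_welfare_def expected_utility_eq potential_def total_externality_def
      sum_subtractf flip: sum_distrib_left)

text \<open>The normalisation bounds the externality a buyer causes, not the one she suffers, so the
  double sum is first regrouped by the causing buyer.\<close>

lemma total_externality_range: "total_externality G S \<in> {0..real CARD('b)}"
proof -
  have eq: "total_externality G S = (\<Sum>i\<in>UNIV. \<Sum>j\<in>UNIV - {i}. mean_externality G j i (S j) (S i))"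
    unfolding total_externality_def by (rule sum_offdiag_swap[symmetric])
  have "total_externality G S \<le> of_nat (card (UNIV :: 'b set)) * 1"
    unfolding eq by (rule sum_bounded_above) (use caused_externality_normalized in auto)
  moreover have "0 \<le> total_externality G S"
    unfolding eq by (rule sum_nonneg) (use caused_externality_normalized in auto)
  ultimately show ?thesis by simp
qed

text \<open>The factor 2 on the left reflects that a deviation compares two profiles, each of which
  may contribute half of the bound.\<close>

lemma abs_expected_utility_minus_shared_utility_le:
  "2 * \<bar>expected_utility G \<alpha> i S - shared_utility G i S\<bar> \<le>
     2 * \<bar>\<alpha> - 0.5\<bar> * (\<Sum>j\<in>UNIV - {i}.
       MAX x. MAX y. \<bar>mean_prediction G j i y x - mean_prediction G i j x y\<bar>)
     + (\<Sum>j\<in>UNIV - {i}. MAX x. MAX y. \<bar>bias G i j x y - bias G j i y x\<bar>)"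
proof -
  define p where "p j = mean_prediction G j i (S j) (S i) - mean_prediction G i j (S i) (S j)" for j
  define b where "b j = bias G i j (S i) (S j) - bias G j i (S j) (S i)" for j
  have "2 * (expected_utility G \<alpha> i S - shared_utility G i S) =
      (\<Sum>j\<in>UNIV - {i}. mean_externality G j i (S j) (S i) - mean_externality G i j (S i) (S j))
      - 2 * \<alpha> * (\<Sum>j\<in>UNIV - {i}. p j)"
    by (simp add: expected_utility_eq shared_utility_def p_def sum.distrib sum_subtractf algebra_simps)
  \<comment> \<open>Each mean externality is its mean prediction plus its bias.\<close>
  also have "\<dots> = (\<Sum>j\<in>UNIV - {i}. p j - b j) - 2 * \<alpha> * (\<Sum>j\<in>UNIV - {i}. p j)"
    by (simp add: p_def b_def bias_def algebra_simps)
  also have "\<dots> = - (2 * (\<alpha> - 0.5)) * (\<Sum>j\<in>UNIV - {i}. p j) - (\<Sum>j\<in>UNIV - {i}. b j)"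
    by (simp add: sum_subtractf algebra_simps)
  finally have eq: "2 * (expected_utility G \<alpha> i S - shared_utility G i S) = \<dots>" .
  have "2 * \<bar>expected_utility G \<alpha> i S - shared_utility G i S\<bar> =
      \<bar>2 * (expected_utility G \<alpha> i S - shared_utility G i S)\<bar>"
    by (simp only: abs_mult abs_numeral)
  also have "\<dots> \<le> 2 * \<bar>\<alpha> - 0.5\<bar> * \<bar>\<Sum>j\<in>UNIV - {i}. p j\<bar> + \<bar>\<Sum>j\<in>UNIV - {i}. b j\<bar>"
    unfolding eq by (rule order.trans[OF abs_triangle_ineq4])
      (simp only: abs_mult abs_minus_cancel abs_numeral order.refl)
  also have "\<dots> \<le> 2 * \<bar>\<alpha> - 0.5\<bar> * (\<Sum>j\<in>UNIV - {i}. \<bar>p j\<bar>) + (\<Sum>j\<in>UNIV - {i}. \<bar>b j\<bar>)"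
    by (intro add_mono mult_left_mono sum_abs) auto
  also have "\<dots> \<le> 2 * \<bar>\<alpha> - 0.5\<bar> * (\<Sum>j\<in>UNIV - {i}.
       MAX x. MAX y. \<bar>mean_prediction G j i y x - mean_prediction G i j x y\<bar>)
     + (\<Sum>j\<in>UNIV - {i}. MAX x. MAX y. \<bar>bias G i j x y - bias G j i y x\<bar>)"
    unfolding p_def b_def
    by (intro add_mono mult_left_mono sum_mono
        le_MAX_MAX[of "\<lambda>x y. \<bar>mean_prediction G j i y x - mean_prediction G i j x y\<bar>" for j]
        le_MAX_MAX[of "\<lambda>x y. \<bar>bias G i j x y - bias G j i y x\<bar>" for j]) auto
  finally show ?thesis .
qed

end

theorem theorem7:
  fixes G :: "('w, 'b::finite, 's::finite) data_market"
    and \<alpha> \<epsilon> :: real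
  assumes "joint_externality_game G"
    and "\<alpha> \<in> {0..1}"
    and "\<epsilon> = (MAX i.
           2 * \<bar>\<alpha> - 0.5\<bar> * (\<Sum>j\<in>UNIV - {i}.
             MAX x. MAX y. \<bar>mean_prediction G j i y x - mean_prediction G i j x y\<bar>)
           + (\<Sum>j\<in>UNIV - {i}. MAX x. MAX y. \<bar>bias G i j x y - bias G j i y x\<bar>))"
  shows "\<exists>Sq. approx_pure_nash G \<alpha> \<epsilon> Sq \<and>
           (MAX S. social_welfare G \<alpha> S) - social_welfare G \<alpha> Sq \<le> real CARD('b) / 2"
proof -
  interpret joint_externality_game G by fact
  \<comment> \<open>There are only finitely many profiles, so the maximum is attained.\<close>
  have "\<exists>S. potential G S = (MAX S. potential G S)"
    using Max_in[of "range (potential G)"] by fastforce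
  then obtain Sq where "potential G Sq = (MAX S. potential G S)" ..
  then have max: "potential G S \<le> potential G Sq" for S
    by simp
  have close: "2 * \<bar>expected_utility G \<alpha> i S - shared_utility G i S\<bar> \<le> \<epsilon>" for i S
    unfolding assms(3)
    by (rule order.trans[OF abs_expected_utility_minus_shared_utility_le Max_ge]) auto
  \<comment> \<open>The shared utility cannot grow at \<open>Sq\<close>; passing to it and back
    costs \<open>\<epsilon>/2\<close> at each of the two profiles.\<close>
  have "expected_utility G \<alpha> i (Sq(i := x)) \<le> expected_utility G \<alpha> i Sq + \<epsilon>" for i x
    using close[of i "Sq(i := x)"] close[of i Sq] potential_deviation[of G Sq i x] max[of "Sq(i := x)"]
    by (simp add: abs_if split: if_splits)
  \<comment> \<open>The lower bound 0 on the total externality is needed at \<open>S\<close>, the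
    upper bound at \<open>Sq\<close>.\<close>
  moreover have "social_welfare G \<alpha> S \<le> social_welfare G \<alpha> Sq + real CARD('b) / 2" for S
    using max[of S] total_externality_range[of S] total_externality_range[of Sq]
    by (simp add: social_welfare_eq)
  then have "(MAX S. social_welfare G \<alpha> S) \<le> social_welfare G \<alpha> Sq + real CARD('b) / 2"
    by (subst Max_le_iff) auto
  ultimately show ?thesis
    unfolding approx_pure_nash_def diff_le_eq by (metis add.commute)
qed

end
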